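(* Let $P\subset\mathbb{R}^2$ be a finite set of points in convex position. For any two plane spanning trees $T_I$ and $T_F$ of $P$, there exists a shortest flip sequence $T_I=T_0,T_1,\dots,T_k=T_F$ such that every flip in it is either final, or the edge removed by that flip is crossed by another edge later on, i.e. if the flip from $T_i$ to $T_{i+1}$ removes $e$ and is not final, then some edge of some tree $T_j$ with $j\ge i+1$ crosses $e$.
   Context: Edges are straight-line segments $uv$ between distinct points $u,v\in P$. Two edges cross if their segments meet in a point other than a common endpoint. A plane spanning tree of $P$ ($|P|=n$) is a set of $n-1$ pairwise non-crossing edges forming a tree on the vertex set $P$. A flip $e\to f$ in a plane spanning tree $T$ removes an edge $e\in T$ and adds an edge $f\notin T$ such that $T-e+f$ is again a plane spanning tree of $P$ (the edges $e$ and $f$ may cross). A flip sequence from $T_I$ to $T_F$ is a sequence of plane spanning trees $T_I=T_0,T_1,\dots,T_k=T_F$ in which consecutive trees differ by a single flip; its length is $k$, and it is shortest if $k$ is minimum among all flip sequences from $T_I$ to $T_F$. A flip $e\to f$ of the sequence, from $T_i$ to $T_{i+1}$, is final if the added edge $f$ is not removed by any later flip (that is, $f\in T_j$ for all $j\geq i+1$). *)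

theory Defs
  imports "HOL-Analysis.Analysis"
begin

type_synonym point = "real ^ 2"
type_synonym edge = "point set"

definition convex_position :: "point set \<Rightarrow> bool" where
  "convex_position P \<longleftrightarrow> (\<forall>p\<in>P. p extreme_point_of (convex hull P))"

definition edges_on :: "point set \<Rightarrow> edge set" where
  "edges_on P = {{u, v} | u v. u \<in> P \<and> v \<in> P \<and> u \<noteq> v}"

text \<open>
  An edge is the set of its two endpoints, so its segment is \<^term>\<open>convex hull e\<close>,
  and the common endpoints of \<^term>\<open>e\<close> and \<^term>\<open>f\<close> are the elements of \<^term>\<open>e \<inter> f\<close>.
  Without \<^term>\<open>e \<noteq> f\<close> every edge would cross itself.
\<close>
definition crosses :: "edge \<Rightarrow> edge \<Rightarrow> bool" where
  "crosses e f \<longleftrightarrow> e \<noteq> f \<and> (\<exists>x. x \<in> convex hull e \<and> x \<in> convex hull f \<and> x \<notin> e \<inter> f)"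

definition graph_connected :: "'a set \<Rightarrow> 'a set set \<Rightarrow> bool" where
  "graph_connected V E \<longleftrightarrow> (\<forall>u\<in>V. \<forall>v\<in>V. (u, v) \<in> {(x, y). {x, y} \<in> E}\<^sup>*)"

definition graph_cycle :: "'a set set \<Rightarrow> 'a list \<Rightarrow> bool" where
  "graph_cycle E vs \<longleftrightarrow>
     length vs \<ge> 3 \<and> distinct vs \<and> successively (\<lambda>x y. {x, y} \<in> E) vs \<and> {last vs, hd vs} \<in> E"

definition graph_tree :: "'a set \<Rightarrow> 'a set set \<Rightarrow> bool" where
  "graph_tree V E \<longleftrightarrow> V \<noteq> {} \<and> graph_connected V E \<and> (\<nexists>vs. graph_cycle E vs)"

definition plane_spanning_tree :: "point set \<Rightarrow> edge set \<Rightarrow> bool" where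
  "plane_spanning_tree P T \<longleftrightarrow>
     T \<subseteq> edges_on P \<and> card T + 1 = card P \<and>
     (\<forall>e\<in>T. \<forall>f\<in>T. \<not> crosses e f) \<and> graph_tree P T"

definition is_flip :: "point set \<Rightarrow> edge set \<Rightarrow> edge \<Rightarrow> edge \<Rightarrow> edge set \<Rightarrow> bool" where
  "is_flip P T e f T' \<longleftrightarrow>
     plane_spanning_tree P T \<and> plane_spanning_tree P T' \<and>
     e \<in> T \<and> f \<notin> T \<and> T' = insert f (T - {e})"

text \<open>
  A sequence \<open>T\<^sub>0, \<dots>, T\<^sub>k\<close> is a function on \<^typ>\<open>nat\<close> together with its length \<^term>\<open>k\<close>;
  values beyond \<^term>\<open>k\<close> are irrelevant.
\<close>
definition flip_sequence ::
  "point set \<Rightarrow> edge set \<Rightarrow> edge set \<Rightarrow> (nat \<Rightarrow> edge set) \<Rightarrow> nat \<Rightarrow> bool" where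
  "flip_sequence P TI TF T k \<longleftrightarrow>
     T 0 = TI \<and> T k = TF \<and> (\<forall>i\<le>k. plane_spanning_tree P (T i)) \<and>
     (\<forall>i<k. \<exists>e f. is_flip P (T i) e f (T (Suc i)))"

definition shortest_flip_sequence ::
  "point set \<Rightarrow> edge set \<Rightarrow> edge set \<Rightarrow> (nat \<Rightarrow> edge set) \<Rightarrow> nat \<Rightarrow> bool" where
  "shortest_flip_sequence P TI TF T k \<longleftrightarrow>
     flip_sequence P TI TF T k \<and> (\<forall>T' k'. flip_sequence P TI TF T' k' \<longrightarrow> k \<le> k')"

text \<open>The flip from \<open>T\<^sub>i\<close> to \<open>T\<^sub>i\<^sub>+\<^sub>1\<close>, which adds \<^term>\<open>f\<close>, is final.\<close>
definition final_flip :: "(nat \<Rightarrow> edge set) \<Rightarrow> nat \<Rightarrow> nat \<Rightarrow> edge \<Rightarrow> bool" where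
  "final_flip T k i f \<longleftrightarrow> (\<forall>j\<in>{Suc i..k}. f \<in> T j)"

end

theory Submission
  imports Defs
begin

text \<open>
  Among the shortest flip sequences, take one with the longest suffix in which no removed edge is
  crossed afterwards. Within that suffix the tree at its start and the final tree do not cross, so
  they can be exchanged edge by edge; as the sequence is shortest, all flips of the suffix are final.
  If an earlier flip removed an edge \<^term>\<open>e\<close> that is not crossed afterwards, then \<^term>\<open>e\<close> could be
  kept until the very end: the remaining removals can be replayed within the trees augmented by
  \<^term>\<open>e\<close>, and the suffix would become longer. Convex position only serves to see that flip sequences
  exist: the edges crossed by no other edge connect all points, and every tree can be flipped into them.
\<close>

section \<open>Exchanging an edge of a tree\<close>

definition adj :: "'a set set \<Rightarrow> ('a \<times> 'a) set" where
  "adj E = {(x, y). {x, y} \<in> E}"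

lemma mem_adj [simp]: "(x, y) \<in> adj E \<longleftrightarrow> {x, y} \<in> E"
  by (simp add: adj_def)

lemma graph_connected_iff:
  "graph_connected V E \<longleftrightarrow> (\<forall>u\<in>V. \<forall>v\<in>V. (u, v) \<in> (adj E)\<^sup>*)"
  by (simp add: graph_connected_def adj_def)

lemma sym_adj: "sym (adj E)"
  by (auto simp: sym_def insert_commute)

lemma adj_rtrancl_sym: "(x, y) \<in> (adj E)\<^sup>* \<Longrightarrow> (y, x) \<in> (adj E)\<^sup>*"
  by (rule symD[OF sym_rtrancl[OF sym_adj]])

lemma adj_rtrancl_mono: "(x, y) \<in> (adj E)\<^sup>* \<Longrightarrow> E \<subseteq> F \<Longrightarrow> (x, y) \<in> (adj F)\<^sup>*"
  by (erule rev_subsetD, rule rtrancl_mono) (auto simp: adj_def)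

lemma graph_connected_mono: "graph_connected V E \<Longrightarrow> E \<subseteq> F \<Longrightarrow> graph_connected V F"
  unfolding graph_connected_iff using adj_rtrancl_mono[of _ _ E F] by blast

text \<open>A walk is shortcut as it grows: if the next vertex already lies on the path, the path is
  cut off there. Distinct vertices are what \<open>graph_cycle\<close> asks for.\<close>

lemma adj_rtrancl_obtain_path:
  assumes "(u, v) \<in> (adj E)\<^sup>*"
  obtains vs where "vs \<noteq> []" "distinct vs" "hd vs = u" "last vs = v"
    "successively (\<lambda>x y. {x, y} \<in> E) vs"
proof -
  have "\<exists>vs. vs \<noteq> [] \<and> distinct vs \<and> hd vs = u \<and> last vs = v \<and>
      successively (\<lambda>x y. {x, y} \<in> E) vs"
    using assms
  proof (induction rule: rtrancl_induct)
    case base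
    show ?case by (rule exI[of _ "[u]"]) simp
  next
    case (step y z)
    then obtain vs where vs: "vs \<noteq> []" "distinct vs" "hd vs = u" "last vs = y"
      "successively (\<lambda>x y. {x, y} \<in> E) vs" by blast
    show ?case
    proof (cases "z \<in> set vs")
      case True
      then obtain as bs where "vs = as @ z # bs" by (meson split_list)
      then have split: "vs = (as @ [z]) @ bs" by simp
      have "hd (as @ [z]) = u"
        using vs(3) split by (cases as) auto
      moreover have "successively (\<lambda>x y. {x, y} \<in> E) (as @ [z])"
        using vs(5) unfolding split successively_append_iff[of _ "as @ [z]" bs] by blast
      ultimately show ?thesis
        using vs(2) split by (intro exI[of _ "as @ [z]"]) auto
    next
      case False
      then show ?thesis
        using vs step(2) by (intro exI[of _ "vs @ [z]"]) (auto simp: successively_append_iff)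
    qed
  qed
  then show ?thesis using that by blast
qed

lemma successively_adj_rtrancl:
  "vs \<noteq> [] \<Longrightarrow> successively (\<lambda>x y. {x, y} \<in> E) vs \<Longrightarrow> (hd vs, last vs) \<in> (adj E)\<^sup>*"
proof (induction vs)
  case (Cons a vs)
  then show ?case
    by (cases vs) (auto intro: converse_rtrancl_into_rtrancl)
qed simp

lemma not_successively_split:
  "\<not> successively Q vs \<Longrightarrow> \<exists>as a b bs. vs = as @ a # b # bs \<and> \<not> Q a b"
proof (induction vs)
  case (Cons x vs)
  show ?case
  proof (cases "successively Q vs")
    case True
    with Cons.prems obtain y ys where "vs = y # ys" "\<not> Q x y"
      by (cases vs) auto
    then show ?thesis by (intro exI[of _ "[]"]) auto
  next
    case False
    with Cons.IH obtain as a b bs where "vs = as @ a # b # bs" "\<not> Q a b" by blast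
    then show ?thesis by (intro exI[of _ "x # as"]) auto
  qed
qed simp

text \<open>\<open>graph_cycle\<close> treats the closing edge separately; rotation moves any chosen
  edge of the cycle into that place.\<close>

lemma graph_cycle_rotate:
  assumes "graph_cycle E (as @ bs)" "as \<noteq> []" "bs \<noteq> []"
  shows "graph_cycle E (bs @ as)"
  using assms unfolding graph_cycle_def by (auto simp: successively_append_iff)

text \<open>A new cycle has to use \<open>{x, y}\<close>, and its remaining edges would then connect
  \<open>x\<close> and \<open>y\<close> within \<open>E\<close>.\<close>

lemma acyclic_insert:
  assumes acyc: "\<nexists>vs. graph_cycle E vs" and sep: "(x, y) \<notin> (adj E)\<^sup>*"
  shows "\<nexists>vs. graph_cycle (insert {x, y} E) vs"
proof
  let ?F = "insert {x, y} E"
  \<comment> \<open>Case where the new edge closes the cycle. Using it a second time would, by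
    distinctness, leave only two vertices, so the rest is a path in \<open>E\<close>.\<close>
  have closing: False if cyc: "graph_cycle ?F vs" and f: "{last vs, hd vs} = {x, y}" for vs
  proof -
    have vs: "length vs \<ge> 3" "distinct vs" "successively (\<lambda>x y. {x, y} \<in> ?F) vs"
      using cyc by (auto simp: graph_cycle_def)
    have "successively (\<lambda>x y. {x, y} \<in> E) vs"
    proof (rule ccontr)
      assume "\<not> ?thesis"
      then obtain as a b bs where split: "vs = as @ a # b # bs" and "{a, b} \<notin> E"
        using not_successively_split by blast
      moreover have "{a, b} \<in> ?F"
        using vs(3) unfolding split by (auto simp: successively_append_iff)
      ultimately have ab: "{a, b} = {last vs, hd vs}" using f by auto
      have "a \<noteq> last vs" using split vs(2) by (auto simp: last_in_set split: if_splits)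
      with ab have a: "a = hd vs" "b = last vs" by (auto simp: doubleton_eq_iff)
      have "as = []" using a(1) split vs(2) by (cases as) auto
      moreover have "bs = []" using a(2) split vs(2) by (cases bs rule: rev_cases) auto
      ultimately show False using split vs(1) by simp
    qed
    then have "(hd vs, last vs) \<in> (adj E)\<^sup>*"
      using vs(1) by (intro successively_adj_rtrancl) auto
    moreover have "(last vs, hd vs) \<in> (adj E)\<^sup>*"
      using calculation by (rule adj_rtrancl_sym)
    ultimately show False
      using f sep by (auto simp: doubleton_eq_iff)
  qed
  assume "\<exists>vs. graph_cycle ?F vs"
  then obtain vs where cyc: "graph_cycle ?F vs" by blast
  then have last: "{last vs, hd vs} \<in> E"
    using closing by (auto simp: graph_cycle_def)
  with cyc acyc have "\<not> successively (\<lambda>x y. {x, y} \<in> E) vs"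
    by (auto simp: graph_cycle_def)
  \<comment> \<open>Otherwise the new edge occurs inside the list; starting the cycle at
    \<open>b\<close> and ending it at \<open>a\<close> reduces to \<open>closing\<close>.\<close>
  then obtain as a b bs where split: "vs = as @ a # b # bs" and "{a, b} \<notin> E"
    using not_successively_split by blast
  moreover have "{a, b} \<in> ?F"
    using cyc unfolding split graph_cycle_def by (auto simp: successively_append_iff)
  ultimately have "{a, b} = {x, y}" by simp
  moreover have "graph_cycle ?F ((b # bs) @ (as @ [a]))"
    using cyc split by (subst graph_cycle_rotate[of _ "as @ [a]" "b # bs"]) auto
  ultimately show False using closing[of "(b # bs) @ (as @ [a])"] by simp
qed

section \<open>Bridges and edge exchange in trees\<close>

text \<open>A path from \<open>u\<close> to \<open>v\<close> avoiding the edge would be closed by it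
  into a cycle.\<close>

lemma tree_bridge:
  assumes "graph_tree V T" "{u, v} \<in> T" "u \<noteq> v"
  shows "(u, v) \<notin> (adj (T - {{u, v}}))\<^sup>*"
proof
  assume "(u, v) \<in> (adj (T - {{u, v}}))\<^sup>*"
  then obtain vs where vs: "vs \<noteq> []" "distinct vs" "hd vs = u" "last vs = v"
    and succ: "successively (\<lambda>x y. {x, y} \<in> T - {{u, v}}) vs"
    by (rule adj_rtrancl_obtain_path)
  have "length vs \<ge> 3"
  proof (rule ccontr)
    assume "\<not> length vs \<ge> 3"
    then consider a where "vs = [a]" | a b where "vs = [a, b]"
      using vs(1) by (cases vs; cases "tl vs"; cases "tl (tl vs)") auto
    then show False using vs succ assms(3) by cases auto
  qed
  moreover have "successively (\<lambda>x y. {x, y} \<in> T) vs"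
    using succ by (rule successively_mono) auto
  ultimately have "graph_cycle T vs"
    using vs assms(2) by (simp add: graph_cycle_def insert_commute)
  then show False using assms(1) by (auto simp: graph_tree_def)
qed

lemma rtrancl_leaves_set:
  assumes "(u, v) \<in> r\<^sup>*" "u \<in> A" "v \<notin> A"
  shows "\<exists>x y. (x, y) \<in> r \<and> x \<in> A \<and> y \<notin> A"
  using assms by (induction rule: rtrancl_induct) auto

text \<open>Deleting \<open>{u, v}\<close> splits the tree into the component \<open>A\<close> of
  \<open>u\<close> and that of \<open>v\<close>. A connected \<open>G\<close> has an edge leaving
  \<open>A\<close>, and this edge rejoins the two. It may be \<open>{u, v}\<close> itself.\<close>

lemma tree_exchange:
  assumes T: "graph_tree V T" and uv: "{u, v} \<in> T" "u \<in> V" "v \<in> V" "u \<noteq> v"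
    and G: "graph_connected V G" "G \<subseteq> Pow V"
  shows "\<exists>f\<in>G. f \<notin> T - {{u, v}} \<and> graph_tree V (insert f (T - {{u, v}}))"
proof -
  let ?F = "T - {{u, v}}"
  define A where "A = {w. (u, w) \<in> (adj ?F)\<^sup>*}"
  have "v \<notin> A" using tree_bridge[OF T uv(1) uv(4)] by (simp add: A_def)
  moreover have "(u, v) \<in> (adj G)\<^sup>*" "u \<in> A"
    using G uv by (auto simp: graph_connected_iff A_def)
  ultimately obtain x y where xy: "{x, y} \<in> G" "x \<in> A" "y \<notin> A"
    using rtrancl_leaves_set[of u v "adj G" A] by auto
  have sep: "(x, y) \<notin> (adj ?F)\<^sup>*"
    using xy by (auto simp: A_def intro: rtrancl_trans)
  then have notin: "{x, y} \<notin> ?F" using r_into_rtrancl[of "(x, y)" "adj ?F"] by fastforce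
  let ?S = "insert {x, y} ?F"
  \<comment> \<open>On a tree path from \<open>u\<close>, traversing the deleted edge arrives at
    \<open>u\<close> or \<open>v\<close>, from where the search simply restarts.\<close>
  have two_sides: "(u, w) \<in> (adj ?F)\<^sup>* \<or> (v, w) \<in> (adj ?F)\<^sup>*" if "w \<in> V" for w
  proof -
    have "(u, w) \<in> (adj T)\<^sup>*" using T uv that by (auto simp: graph_tree_def graph_connected_iff)
    then show ?thesis
    proof (induction rule: rtrancl_induct)
      case (step y z)
      show ?case
      proof (cases "{y, z} = {u, v}")
        case True
        then show ?thesis by (auto simp: doubleton_eq_iff)
      next
        case False
        then have "(y, z) \<in> adj ?F" using step by auto
        then show ?thesis using step.IH by (meson rtrancl.rtrancl_into_rtrancl)
      qed
    qed simp
  qed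
  have "y \<in> V" using xy G by auto
  then have vy: "(v, y) \<in> (adj ?F)\<^sup>*" using two_sides xy by (auto simp: A_def)
  have up: "(s, t) \<in> (adj ?S)\<^sup>*" if "(s, t) \<in> (adj ?F)\<^sup>*" for s t
    using that by (rule adj_rtrancl_mono) auto
  have "(u, x) \<in> (adj ?S)\<^sup>*" using xy(2) by (intro up) (simp only: A_def mem_Collect_eq)
  moreover have "(x, y) \<in> (adj ?S)\<^sup>*" by auto
  moreover have "(y, v) \<in> (adj ?S)\<^sup>*" using up[OF vy] by (rule adj_rtrancl_sym)
  ultimately have "(u, v) \<in> (adj ?S)\<^sup>*" by (meson rtrancl_trans)
  then have reach: "(u, w) \<in> (adj ?S)\<^sup>*" if "w \<in> V" for w
    using two_sides[OF that] up by (meson rtrancl_trans)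
  have "graph_connected V ?S"
    unfolding graph_connected_iff
    by (intro ballI rtrancl_trans[OF adj_rtrancl_sym[OF reach] reach])
  moreover have "\<nexists>vs. graph_cycle ?F vs"
  proof
    assume "\<exists>vs. graph_cycle ?F vs"
    then obtain vs where "graph_cycle ?F vs" by blast
    then have "graph_cycle T vs"
      unfolding graph_cycle_def using successively_mono[of _ vs "\<lambda>x y. {x, y} \<in> T"] by blast
    then show False using T by (auto simp: graph_tree_def)
  qed
  then have "\<nexists>vs. graph_cycle ?S vs" using sep by (rule acyclic_insert)
  ultimately show ?thesis
    using T xy notin by (intro bexI[of _ "{x, y}"]) (auto simp: graph_tree_def)
qed

section \<open>Flip sequences\<close>

definition noncrossing :: "edge set \<Rightarrow> bool" where
  "noncrossing E \<longleftrightarrow> (\<forall>e\<in>E. \<forall>f\<in>E. \<not> crosses e f)"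

lemma noncrossing_subset: "noncrossing F \<Longrightarrow> E \<subseteq> F \<Longrightarrow> noncrossing E"
  by (auto simp: noncrossing_def)

lemma crosses_sym: "crosses e f \<longleftrightarrow> crosses f e"
  by (auto simp: crosses_def)

lemma noncrossing_insert:
  assumes "noncrossing E" "\<forall>g\<in>E. \<not> crosses g e"
  shows "noncrossing (insert e E)"
proof -
  have "\<not> crosses e e" by (simp add: crosses_def)
  moreover have "\<forall>g\<in>E. \<not> crosses e g" using assms(2) crosses_sym by blast
  ultimately show ?thesis using assms by (auto simp: noncrossing_def)
qed

text \<open>A relation, so that flip sequences of length \<open>k\<close> correspond to the power
  \<open>flip_rel P ^^ k\<close> and can be concatenated.\<close>

definition flip_rel :: "point set \<Rightarrow> edge set rel" where
  "flip_rel P = {(T, T'). \<exists>e f. is_flip P T e f T'}"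

lemma plane_spanning_tree_edges: "plane_spanning_tree P T \<Longrightarrow> T \<subseteq> edges_on P"
  and plane_spanning_tree_card: "plane_spanning_tree P T \<Longrightarrow> card T + 1 = card P"
  and plane_spanning_tree_noncrossing: "plane_spanning_tree P T \<Longrightarrow> noncrossing T"
  and plane_spanning_tree_connected: "plane_spanning_tree P T \<Longrightarrow> graph_connected P T"
  by (auto simp: plane_spanning_tree_def graph_tree_def noncrossing_def)

lemma finite_edges_on: "finite P \<Longrightarrow> finite (edges_on P)"
  by (rule finite_subset[of _ "Pow P"]) (auto simp: edges_on_def)

lemma plane_spanning_tree_finite: "finite P \<Longrightarrow> plane_spanning_tree P T \<Longrightarrow> finite T"
  using finite_edges_on finite_subset plane_spanning_tree_edges by blast

lemma plane_spanning_tree_subset_eq: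
  assumes "finite P" "plane_spanning_tree P S" "plane_spanning_tree P T" "S \<subseteq> T"
  shows "S = T"
  using assms plane_spanning_tree_card[of P S] plane_spanning_tree_card[of P T]
    plane_spanning_tree_finite[of P T] by (intro card_subset_eq) auto

lemma flip_relD:
  assumes "(T, T') \<in> flip_rel P"
  shows "plane_spanning_tree P T" "plane_spanning_tree P T'"
  using assms by (auto simp: flip_rel_def is_flip_def)

text \<open>Every flip certifies that both of its trees are plane; for \<open>k = 0\<close> this
  comes from the assumption on \<open>A\<close>.\<close>

lemma flip_sequence_iff:
  assumes "plane_spanning_tree P A"
  shows "flip_sequence P A B T k \<longleftrightarrow>
    T 0 = A \<and> T k = B \<and> (\<forall>i<k. (T i, T (Suc i)) \<in> flip_rel P)"
proof -
  have "plane_spanning_tree P (T i)"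
    if "T 0 = A" "\<forall>i<k. (T i, T (Suc i)) \<in> flip_rel P" "i \<le> k" for i
    using that assms flip_relD(2)[of "T (i - 1)" "T i"] by (cases i) auto
  then show ?thesis
    by (auto simp: flip_sequence_def flip_rel_def)
qed

lemma ex_flip_sequence_iff:
  assumes "plane_spanning_tree P A"
  shows "(\<exists>T. flip_sequence P A B T k) \<longleftrightarrow> (A, B) \<in> flip_rel P ^^ k"
  by (simp add: flip_sequence_iff[OF assms] relpow_fun_conv)

section \<open>Flipping towards a compatible connected graph\<close>

text \<open>Whichever edge of \<open>G\<close> the exchange picks, the result stays plane, because
  \<open>G\<close> and the rest of the tree are jointly noncrossing.\<close>

lemma plane_tree_exchange:
  assumes fin: "finite P" and T: "plane_spanning_tree P T" and a: "a \<in> T"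
    and G: "graph_connected P G" "G \<subseteq> edges_on P" "noncrossing (T - {a} \<union> G)"
  obtains f where "f \<in> G" "f \<notin> T - {a}" "plane_spanning_tree P (insert f (T - {a}))"
proof -
  obtain u v where uv: "a = {u, v}" "u \<in> P" "v \<in> P" "u \<noteq> v"
    using plane_spanning_tree_edges[OF T] a by (auto simp: edges_on_def)
  have "graph_tree P T" using T by (simp add: plane_spanning_tree_def)
  moreover have "G \<subseteq> Pow P" using G(2) by (auto simp: edges_on_def)
  ultimately obtain f where f: "f \<in> G" "f \<notin> T - {a}" "graph_tree P (insert f (T - {a}))"
    using tree_exchange[of P T u v G] G(1) a uv by blast
  have "finite T" using fin T by (rule plane_spanning_tree_finite)
  then have "card (insert f (T - {a})) = Suc (card (T - {a}))"
    using f(2) by (intro card_insert_disjoint) auto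
  also have "\<dots> = card T" using \<open>finite T\<close> a by (rule card_Suc_Diff1)
  finally have "card (insert f (T - {a})) + 1 = card P"
    using plane_spanning_tree_card[OF T] by simp
  moreover have "noncrossing (insert f (T - {a}))"
    using G(3) f(1) by (elim noncrossing_subset) auto
  moreover have "insert f (T - {a}) \<subseteq> edges_on P"
    using plane_spanning_tree_edges[OF T] f(1) G(2) by auto
  ultimately have "plane_spanning_tree P (insert f (T - {a}))"
    using f(3) by (simp add: plane_spanning_tree_def noncrossing_def)
  with f that show ?thesis by blast
qed

text \<open>The reflexive closure covers an exchange that returns the removed edge.\<close>

lemma flip_relI:
  assumes "plane_spanning_tree P T" "plane_spanning_tree P (insert f (T - {a}))"
    "a \<in> T" "f \<notin> T - {a}"
  shows "(T, insert f (T - {a})) \<in> (flip_rel P)\<^sup>="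
proof (cases "f = a")
  case True
  then show ?thesis using assms(3) by (simp add: insert_absorb)
next
  case False
  then have "is_flip P T a f (insert f (T - {a}))" using assms by (auto simp: is_flip_def)
  then show ?thesis by (auto simp: flip_rel_def)
qed

text \<open>Each exchange replaces an edge outside \<open>G\<close> by one inside, so it is a proper
  flip and lowers \<open>card (T - G)\<close> by exactly one. All trees on the way stay within
  \<open>T \<union> G\<close>.\<close>

lemma flips_into_connected:
  assumes fin: "finite P" and T: "plane_spanning_tree P T"
    and G: "graph_connected P G" "G \<subseteq> edges_on P" "noncrossing (T \<union> G)"
  shows "\<exists>S\<subseteq>G. plane_spanning_tree P S \<and> (T, S) \<in> flip_rel P ^^ card (T - G)"
  using T G(3)
proof (induction "card (T - G)" arbitrary: T)
  case 0
  then have "T \<subseteq> G" using plane_spanning_tree_finite[OF fin] by auto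
  with 0 show ?case by (intro exI[of _ T]) auto
next
  case (Suc n)
  then obtain a where a: "a \<in> T" "a \<notin> G" by (metis Diff_iff card_0_eq card.infinite equals0I nat.simps(3))
  have "noncrossing (T - {a} \<union> G)" using Suc.prems(2) by (rule noncrossing_subset) auto
  with fin Suc.prems(1) a(1) G(1,2) obtain f
    where f: "f \<in> G" "f \<notin> T - {a}" "plane_spanning_tree P (insert f (T - {a}))"
    by (rule plane_tree_exchange)
  let ?T = "insert f (T - {a})"
  have "(T, ?T) \<in> flip_rel P"
    using flip_relI[OF Suc.prems(1) f(3) a(1) f(2)] a f(1) by auto
  moreover have "?T - G = (T - G) - {a}" using f(1) by auto
  then have n: "n = card (?T - G)"
    using Suc.hyps(2) a plane_spanning_tree_finite[OF fin Suc.prems(1)] by simp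
  moreover have "noncrossing (?T \<union> G)" using Suc.prems(2) by (rule noncrossing_subset) (use f in auto)
  ultimately obtain S where "S \<subseteq> G" "plane_spanning_tree P S" "(?T, S) \<in> flip_rel P ^^ n"
    using Suc.hyps(1)[OF n f(3)] by blast
  with \<open>(T, ?T) \<in> flip_rel P\<close> have "(T, S) \<in> flip_rel P ^^ Suc n"
    by (intro relpow_Suc_I2)
  with \<open>S \<subseteq> G\<close> \<open>plane_spanning_tree P S\<close> Suc.hyps(2) show ?case by auto
qed

text \<open>Taking \<open>G\<close> to be the target tree: a spanning tree contained in
  \<open>T\<close> is \<open>T\<close> itself, by counting edges.\<close>

lemma flips_to_tree:
  assumes fin: "finite P" and S: "plane_spanning_tree P S" and T: "plane_spanning_tree P T"
    and "noncrossing (S \<union> T)"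
  shows "(S, T) \<in> flip_rel P ^^ card (S - T)"
proof -
  obtain U where "U \<subseteq> T" "plane_spanning_tree P U" "(S, U) \<in> flip_rel P ^^ card (S - T)"
    using flips_into_connected[OF fin S plane_spanning_tree_connected[OF T]
      plane_spanning_tree_edges[OF T] assms(4)] by blast
  moreover from this have "U = T" using plane_spanning_tree_subset_eq fin T by blast
  ultimately show ?thesis by simp
qed

lemma lazy_sequence_relpow:
  assumes "\<forall>j<k. (N j, N (Suc j)) \<in> R\<^sup>="
  shows "\<exists>m\<le>k. (N 0, N k) \<in> R ^^ m \<and> ((\<exists>j<k. N j = N (Suc j)) \<longrightarrow> m < k)"
  using assms
proof (induction k)
  case (Suc k)
  then obtain m where m: "m \<le> k" "(N 0, N k) \<in> R ^^ m" "(\<exists>j<k. N j = N (Suc j)) \<longrightarrow> m < k"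
    by auto
  show ?case
  proof (cases "N k = N (Suc k)")
    case True
    with m show ?thesis by (intro exI[of _ m]) auto
  next
    case False
    with Suc.prems have "(N k, N (Suc k)) \<in> R" by auto
    with m(2) have "(N 0, N (Suc k)) \<in> R ^^ Suc m" by (rule relpow_Suc_I)
    with m False show ?thesis by (intro exI[of _ "Suc m"]) (auto simp: less_Suc_eq)
  qed
qed auto

lemma relpow_suffix:
  assumes "\<forall>j. m \<le> j \<and> j < k \<longrightarrow> (N j, N (Suc j)) \<in> R" "m \<le> k"
  shows "(N m, N k) \<in> R ^^ (k - m)"
  unfolding relpow_fun_conv using assms by (intro exI[of _ "\<lambda>i. N (m + i)"]) auto

section \<open>The boundary of a set in convex position\<close>

text \<open>Deleting an extreme point leaves the hull convex, and what is left contains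
  \<open>P - {q}\<close>.\<close>

lemma convex_position_notin_hull:
  assumes "convex_position P" "q \<in> P"
  shows "q \<notin> convex hull (P - {q})"
proof -
  have "convex (convex hull P - {q})"
    using assms by (simp add: convex_position_def extreme_point_of_stillconvex)
  moreover have "P - {q} \<subseteq> convex hull P - {q}" using hull_subset[of P convex] by auto
  ultimately have "convex hull (P - {q}) \<subseteq> convex hull P - {q}" by (rule hull_minimal[rotated])
  then show ?thesis by auto
qed

lemma edge_segment: "convex hull {x, y} = closed_segment x y" for x y :: point
  by (simp add: segment_convex_hull)

text \<open>
  In the coordinates \<^term>\<open>(h, g)\<close> around \<^term>\<open>p\<close>, all other points lie in an open half plane, so
  that their slopes \<open>\<sigma>\<close>, defined below, order them by angle.
\<close>
locale fan =
  fixes P :: "point set" and p :: point and h g :: "point \<Rightarrow> real"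
  assumes fin: "finite P" and p: "p \<in> P"
    and ext: "q \<in> P \<Longrightarrow> q \<notin> convex hull (P - {q})"
    and lin: "linear h" "linear g"
    and inj: "h v = 0 \<Longrightarrow> g v = 0 \<Longrightarrow> v = 0"
    and pos: "q \<in> P - {p} \<Longrightarrow> h (q - p) > 0"
begin

definition \<sigma> :: "point \<Rightarrow> real" where "\<sigma> q = g (q - p) / h (q - p)"

text \<open>An affine functional vanishing at \<open>p\<close> and, for \<open>q\<close> in
  \<open>P - {p}\<close>, at \<open>q\<close>: its sign tells the side of the line through them, and
  on \<open>P - {p}\<close> it compares slopes.\<close>

definition \<phi> :: "point \<Rightarrow> point \<Rightarrow> real" where "\<phi> q z = g (z - p) - \<sigma> q * h (z - p)"

lemma g_eq: "z \<in> P - {p} \<Longrightarrow> g (z - p) = \<sigma> z * h (z - p)"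
  using pos[of z] by (simp add: \<sigma>_def)

lemma \<phi>_eq: "z \<in> P - {p} \<Longrightarrow> \<phi> q z = (\<sigma> z - \<sigma> q) * h (z - p)"
  by (simp add: \<phi>_def g_eq algebra_simps)

lemma affine_comb: "(1 - t) *\<^sub>R x + t *\<^sub>R y - p = (1 - t) *\<^sub>R (x - p) + t *\<^sub>R (y - p)" for x y :: point
  by (simp add: algebra_simps)

lemma h_comb: "h ((1 - t) *\<^sub>R x + t *\<^sub>R y - p) = (1 - t) * h (x - p) + t * h (y - p)"
  unfolding affine_comb by (simp only: linear_add[OF lin(1)] linear_cmul[OF lin(1)] real_scaleR_def)

lemma \<phi>_comb: "\<phi> q ((1 - t) *\<^sub>R x + t *\<^sub>R y) = (1 - t) * \<phi> q x + t * \<phi> q y"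
  unfolding \<phi>_def h_comb
  unfolding affine_comb linear_add[OF lin(2)] linear_cmul[OF lin(2)] real_scaleR_def
  by (simp add: algebra_simps)

text \<open>Points of equal slope share a ray from \<open>p\<close>; the nearer one would lie on the
  segment from \<open>p\<close> to the farther one.\<close>

lemma \<sigma>_inj:
  assumes "x \<in> P - {p}" "y \<in> P - {p}" "\<sigma> x = \<sigma> y"
  shows "x = y"
proof -
  have *: "x = y" if le: "h (x - p) \<le> h (y - p)" and xy: "x \<in> P - {p}" "y \<in> P - {p}" "\<sigma> x = \<sigma> y" for x y
  proof (rule ccontr)
    assume "x \<noteq> y"
    define t where "t = h (x - p) / h (y - p)"
    have t: "0 \<le> t" "t \<le> 1" "h (x - p) = t * h (y - p)"
      using pos[OF xy(1)] pos[OF xy(2)] le by (auto simp: t_def)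
    have "x - p - t *\<^sub>R (y - p) = 0"
      using t(3) g_eq[OF xy(1)] g_eq[OF xy(2)] xy(3)
      by (intro inj) (simp_all add: linear_diff[OF lin(1)] linear_diff[OF lin(2)]
          linear_cmul[OF lin(1)] linear_cmul[OF lin(2)])
    then have "x = (1 - t) *\<^sub>R p + t *\<^sub>R y" by (simp add: algebra_simps)
    then have "x \<in> convex hull {p, y}"
      using t unfolding edge_segment in_segment by blast
    moreover have "convex hull {p, y} \<subseteq> convex hull (P - {x})"
      using xy p \<open>x \<noteq> y\<close> by (intro hull_mono) auto
    ultimately show False using ext[of x] xy by auto
  qed
  show ?thesis
    using *[of x y] *[of y x] assms by (cases "h (x - p) \<le> h (y - p)") auto
qed

text \<open>
  A point whose ray lies between those of \<^term>\<open>x\<close> and \<^term>\<open>y\<close> lies beyond the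
  line through \<^term>\<open>x\<close> and \<^term>\<open>y\<close>, as otherwise it would be in the triangle \<^term>\<open>{p, x, y}\<close>.
\<close>
lemma between_beyond:
  assumes q: "q \<in> P - {p}" and x: "x \<in> P - {p}" and y: "y \<in> P - {p}"
    and \<sigma>: "\<sigma> x < \<sigma> y" "\<sigma> x \<le> \<sigma> q" "\<sigma> q \<le> \<sigma> y"
  obtains a b where "q - p = a *\<^sub>R (x - p) + b *\<^sub>R (y - p)" "a + b \<ge> 1"
    "a + b = 1 \<Longrightarrow> q \<in> {x, y}"
proof -
  \<comment> \<open>\<open>l\<close> is the relative position of the slope of \<open>q\<close>
    between the other two; \<open>a\<close> and \<open>b\<close> are the resulting coordinates of
    \<open>q - p\<close> in the basis \<open>x - p\<close>, \<open>y - p\<close>.\<close>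
  define l where "l = (\<sigma> q - \<sigma> x) / (\<sigma> y - \<sigma> x)"
  define a where "a = (1 - l) * h (q - p) / h (x - p)"
  define b where "b = l * h (q - p) / h (y - p)"
  note pos' = pos[OF q] pos[OF x] pos[OF y]
  have l: "0 \<le> l" "l \<le> 1" "l * (\<sigma> y - \<sigma> x) = \<sigma> q - \<sigma> x"
    using \<sigma> by (auto simp: l_def)
  have ab: "a \<ge> 0" "b \<ge> 0" using l pos' by (auto simp: a_def b_def)
  have ah: "a * h (x - p) = (1 - l) * h (q - p)" and bh: "b * h (y - p) = l * h (q - p)"
    using pos' by (auto simp: a_def b_def)
  have "a * g (x - p) + b * g (y - p) = \<sigma> x * (a * h (x - p)) + \<sigma> y * (b * h (y - p))"
    by (simp add: g_eq[OF x] g_eq[OF y])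
  also have "\<dots> = (\<sigma> x + l * (\<sigma> y - \<sigma> x)) * h (q - p)"
    unfolding ah bh by (simp add: algebra_simps)
  also have "\<dots> = g (q - p)" unfolding l(3) by (simp add: g_eq[OF q])
  finally have g: "g (q - p) = a * g (x - p) + b * g (y - p)" by simp
  have "q - p - (a *\<^sub>R (x - p) + b *\<^sub>R (y - p)) = 0"
  proof (rule inj)
    show "h (q - p - (a *\<^sub>R (x - p) + b *\<^sub>R (y - p))) = 0"
      using ah bh
      by (simp add: linear_diff[OF lin(1), of "q - p"] linear_add[OF lin(1)] linear_cmul[OF lin(1)]
          left_diff_distrib)
    show "g (q - p - (a *\<^sub>R (x - p) + b *\<^sub>R (y - p))) = 0"
      using g by (simp add: linear_diff[OF lin(2), of "q - p"] linear_add[OF lin(2)] linear_cmul[OF lin(2)])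
  qed
  then have eq: "q - p = a *\<^sub>R (x - p) + b *\<^sub>R (y - p)" by simp
  have in_xy: "q \<in> {x, y}" if "a + b \<le> 1"
  proof (rule ccontr)
    assume "q \<notin> {x, y}"
    have "q = (1 - a - b) *\<^sub>R p + a *\<^sub>R x + b *\<^sub>R y" using eq by (simp add: algebra_simps)
    then have "q \<in> convex hull {p, x, y}"
      using that ab unfolding convex_hull_3 by force
    moreover have "convex hull {p, x, y} \<subseteq> convex hull (P - {q})"
      using x y q p \<open>q \<notin> {x, y}\<close> by (intro hull_mono) auto
    ultimately show False using ext[of q] q by auto
  qed
  \<comment> \<open>A sum below 1 makes \<open>q\<close> equal to \<open>x\<close> or
    \<open>y\<close> by \<open>in_xy\<close>, but there the coordinates are (1, 0) or (0,
    1).\<close>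
  have "a + b \<ge> 1"
  proof (rule ccontr)
    assume "\<not> a + b \<ge> 1"
    with in_xy consider "q = x" | "q = y" by fastforce
    then show False
    proof cases
      case 1
      then have "l = 0" by (simp add: l_def)
      then show ?thesis using 1 \<open>\<not> a + b \<ge> 1\<close> pos' by (simp add: a_def b_def)
    next
      case 2
      then have "l = 1" using \<sigma> by (simp add: l_def)
      then show ?thesis using 2 \<open>\<not> a + b \<ge> 1\<close> pos' by (simp add: a_def b_def)
    qed
  qed
  with eq in_xy show ?thesis by (intro that[of a b]) auto
qed

text \<open>Different slopes make \<open>x - p\<close> and \<open>y - p\<close> independent. The
  coefficient sum is kept because it is 1 exactly on the line through \<open>x\<close> and
  \<open>y\<close>.\<close>

lemma comb_unique:
  assumes x: "x \<in> P - {p}" and y: "y \<in> P - {p}" and "\<sigma> x < \<sigma> y"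
    and eq: "a *\<^sub>R (x - p) + b *\<^sub>R (y - p) = c *\<^sub>R (x - p) + d *\<^sub>R (y - p)"
  shows "a + b = c + d"
proof -
  have "a * h (x - p) + b * h (y - p) = c * h (x - p) + d * h (y - p)"
    using arg_cong[OF eq, of h] by (simp add: linear_add[OF lin(1)] linear_cmul[OF lin(1)])
  then have 1: "(a - c) * h (x - p) + (b - d) * h (y - p) = 0" by (simp add: algebra_simps)
  have "a * g (x - p) + b * g (y - p) = c * g (x - p) + d * g (y - p)"
    using arg_cong[OF eq, of g] by (simp add: linear_add[OF lin(2)] linear_cmul[OF lin(2)])
  then have "(a - c) * (\<sigma> x * h (x - p)) + (b - d) * (\<sigma> y * h (y - p)) = 0"
    by (simp add: g_eq[OF x] g_eq[OF y] algebra_simps)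
  moreover have "(a - c) * (\<sigma> x * h (x - p)) + (b - d) * (\<sigma> y * h (y - p)) =
      \<sigma> x * ((a - c) * h (x - p) + (b - d) * h (y - p)) + (\<sigma> y - \<sigma> x) * ((b - d) * h (y - p))"
    by (simp add: algebra_simps)
  ultimately have "b = d" using 1 pos[OF y] assms(3) by auto
  with 1 pos[OF x] show ?thesis by auto
qed

lemma edge_crossing_cases:
  assumes "crosses e f" "e = {a, b}" "f = {x, y}"
  obtains w s t where "0 \<le> t" "t \<le> 1" "w = (1 - t) *\<^sub>R a + t *\<^sub>R b"
    "0 \<le> s" "s \<le> 1" "w = (1 - s) *\<^sub>R x + s *\<^sub>R y" "w \<notin> {a, b} \<inter> {x, y}"
proof -
  obtain w where w: "w \<in> closed_segment a b" "w \<in> closed_segment x y" "w \<notin> {a, b} \<inter> {x, y}"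
    using assms(1) unfolding assms(2,3) crosses_def edge_segment by blast
  then obtain t s where "0 \<le> t" "t \<le> 1" "w = (1 - t) *\<^sub>R a + t *\<^sub>R b"
    "0 \<le> s" "s \<le> 1" "w = (1 - s) *\<^sub>R x + s *\<^sub>R y"
    unfolding in_segment by blast
  with w(3) that show ?thesis by blast
qed

section \<open>Boundary edges\<close>

text \<open>The line through \<open>p\<close> and \<open>q\<close> supports \<open>P\<close>:
  \<open>\<phi> q\<close> is nonnegative on \<open>P\<close> and vanishes only at \<open>p\<close>
  and \<open>q\<close>.\<close>

lemma first_uncrossed:
  assumes q: "q \<in> P - {p}" and first: "\<And>z. z \<in> P - {p} \<Longrightarrow> \<sigma> q \<le> \<sigma> z" and f: "f \<in> edges_on P"
  shows "\<not> crosses {p, q} f"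
proof
  assume cross: "crosses {p, q} f"
  obtain x y where xy: "f = {x, y}" "x \<in> P" "y \<in> P" "x \<noteq> y" "y \<noteq> p"
    using f unfolding edges_on_def by (smt (verit, best) insert_commute mem_Collect_eq)
  obtain w s t where w: "0 \<le> t" "t \<le> 1" "w = (1 - t) *\<^sub>R p + t *\<^sub>R q"
    "0 \<le> s" "s \<le> 1" "w = (1 - s) *\<^sub>R x + s *\<^sub>R y" "w \<notin> {p, q} \<inter> {x, y}"
    by (rule edge_crossing_cases[OF cross refl xy(1)])
  have zero: "\<phi> q w = 0"
    unfolding w(3) \<phi>_comb by (simp add: \<phi>_eq[OF q]) (simp add: \<phi>_def linear_0[OF lin(1)] linear_0[OF lin(2)])
  have y: "y \<in> P - {p}" using xy by auto
  have \<phi>y: "\<phi> q y \<ge> 0" "\<phi> q y = 0 \<Longrightarrow> y = q"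
    using \<phi>_eq[OF y] first[OF y] pos[OF y] \<sigma>_inj[OF y q] by auto
  show False
  proof (cases "x = p")
    case True
    with cross xy have "y \<noteq> q" by (auto simp: crosses_def)
    moreover have "s * \<phi> q y = 0"
      using zero unfolding w(6) \<phi>_comb by (simp add: True \<phi>_def linear_0[OF lin(1)] linear_0[OF lin(2)])
    ultimately have "s = 0" using \<phi>y by auto
    then show False using w True by auto
  next
    case False
    then have x: "x \<in> P - {p}" using xy by auto
    have \<phi>x: "\<phi> q x \<ge> 0" "\<phi> q x = 0 \<Longrightarrow> x = q"
      using \<phi>_eq[OF x] first[OF x] pos[OF x] \<sigma>_inj[OF x q] by auto
    have "(1 - s) * \<phi> q x + s * \<phi> q y = 0" using zero unfolding w(6) \<phi>_comb .
    \<comment> \<open>Nonnegative terms with sum 0 both vanish, so the crossing point is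
      \<open>q\<close>, a common endpoint.\<close>
    moreover have "(1 - s) * \<phi> q x \<ge> 0" "s * \<phi> q y \<ge> 0" using w \<phi>x \<phi>y by auto
    ultimately have "(1 - s) * \<phi> q x = 0" "s * \<phi> q y = 0" by linarith+
    then have "s = 1 \<and> y = q \<or> s = 0 \<and> x = q"
      using \<phi>x \<phi>y xy(4) by auto
    then show False using w by auto
  qed
qed

text \<open>No slope lies strictly between those of \<open>q\<close> and \<open>r\<close>. So an
  edge \<open>{x, y}\<close> avoiding \<open>p\<close> could only cross if its slopes enclose both;
  but then \<open>q\<close> and \<open>r\<close> lie on or beyond its line, on it only as
  endpoints.\<close>

lemma consecutive_uncrossed:
  assumes q: "q \<in> P - {p}" and r: "r \<in> P - {p}" and qr: "\<sigma> q < \<sigma> r"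
    and consec: "\<And>z. z \<in> P - {p} \<Longrightarrow> \<sigma> z \<le> \<sigma> q \<or> \<sigma> r \<le> \<sigma> z"
    and f: "f \<in> edges_on P"
  shows "\<not> crosses {q, r} f"
proof
  assume cross: "crosses {q, r} f"
  \<comment> \<open>For an edge from \<open>p\<close> to \<open>y\<close>, \<open>\<phi> y\<close>
    has the same weak sign at \<open>q\<close> and \<open>r\<close>, since neither slope gap
    contains \<open>y\<close>.\<close>
  have no_p: False if xy: "f = {p, y}" "y \<in> P - {p}" for y
  proof -
    obtain w s t where w: "0 \<le> t" "t \<le> 1" "w = (1 - t) *\<^sub>R q + t *\<^sub>R r"
      "0 \<le> s" "s \<le> 1" "w = (1 - s) *\<^sub>R p + s *\<^sub>R y" "w \<notin> {q, r} \<inter> {p, y}"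
      by (rule edge_crossing_cases[OF cross refl xy(1)])
    have "\<phi> y w = 0"
      unfolding w(6) \<phi>_comb by (simp add: \<phi>_eq[OF xy(2)]) (simp add: \<phi>_def linear_0[OF lin(1)] linear_0[OF lin(2)])
    then have sum: "(1 - t) * ((\<sigma> q - \<sigma> y) * h (q - p)) + t * ((\<sigma> r - \<sigma> y) * h (r - p)) = 0"
      unfolding w(3) \<phi>_comb by (simp add: \<phi>_eq[OF q] \<phi>_eq[OF r])
    from consec[OF xy(2)] show False
    proof
      assume le: "\<sigma> y \<le> \<sigma> q"
      then have "(1 - t) * ((\<sigma> q - \<sigma> y) * h (q - p)) \<ge> 0" "t * ((\<sigma> r - \<sigma> y) * h (r - p)) \<ge> 0"
        using w pos[OF q] pos[OF r] qr by auto
      with sum have "(1 - t) * ((\<sigma> q - \<sigma> y) * h (q - p)) = 0" "t * ((\<sigma> r - \<sigma> y) * h (r - p)) = 0"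
        by linarith+
      then have "t = 0" "\<sigma> q = \<sigma> y" using pos[OF q] pos[OF r] qr le by auto
      then show False using w \<sigma>_inj[OF q xy(2)] by auto
    next
      assume le: "\<sigma> r \<le> \<sigma> y"
      then have "(1 - t) * ((\<sigma> q - \<sigma> y) * h (q - p)) \<le> 0" "t * ((\<sigma> r - \<sigma> y) * h (r - p)) \<le> 0"
        using w pos[OF q] pos[OF r] qr by (auto simp: mult_le_0_iff)
      with sum have "(1 - t) * ((\<sigma> q - \<sigma> y) * h (q - p)) = 0" "t * ((\<sigma> r - \<sigma> y) * h (r - p)) = 0"
        by linarith+
      then have "t = 1" "\<sigma> r = \<sigma> y" using pos[OF q] pos[OF r] qr le by auto
      then show False using w \<sigma>_inj[OF r xy(2)] by auto
    qed
  qed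
  have "\<exists>x y. f = {x, y} \<and> x \<in> P \<and> y \<in> P \<and> x \<noteq> y \<and> \<sigma> x \<le> \<sigma> y"
    using f unfolding edges_on_def by (smt (verit, best) insert_commute mem_Collect_eq)
  then obtain x y where xy: "f = {x, y}" "x \<in> P" "y \<in> P" "x \<noteq> y" "\<sigma> x \<le> \<sigma> y" by blast
  have x: "x \<in> P - {p}" and y: "y \<in> P - {p}"
    using xy no_p[of x] no_p[of y] by (auto simp: insert_commute)
  have less: "\<sigma> x < \<sigma> y" using xy \<sigma>_inj[OF x y] by fastforce
  obtain w s t where w: "0 \<le> t" "t \<le> 1" "w = (1 - t) *\<^sub>R q + t *\<^sub>R r"
    "0 \<le> s" "s \<le> 1" "w = (1 - s) *\<^sub>R x + s *\<^sub>R y" "w \<notin> {q, r} \<inter> {x, y}"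
    by (rule edge_crossing_cases[OF cross refl xy(1)])
  \<comment> \<open>Otherwise the ray through \<open>r\<close> separates the edges:
    \<open>\<phi> r\<close> is at most 0 on one and at least 0 on the other. The bound for
    \<open>y\<close> is symmetric, with the ray through \<open>q\<close>.\<close>
  have "\<sigma> x \<le> \<sigma> q"
  proof (rule ccontr)
    assume "\<not> ?thesis"
    with consec[OF x] have ge: "\<sigma> r \<le> \<sigma> x" by auto
    have "(1 - t) * ((\<sigma> q - \<sigma> r) * h (q - p)) = (1 - s) * ((\<sigma> x - \<sigma> r) * h (x - p)) + s * ((\<sigma> y - \<sigma> r) * h (y - p))"
      using \<phi>_comb[of r t q r] \<phi>_comb[of r s x y] w(3,6) by (simp add: \<phi>_eq[OF q] \<phi>_eq[OF r] \<phi>_eq[OF x] \<phi>_eq[OF y])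
    moreover have "(1 - t) * ((\<sigma> q - \<sigma> r) * h (q - p)) \<le> 0"
      using w qr pos[OF q] by (simp add: mult_le_0_iff)
    moreover have "(1 - s) * ((\<sigma> x - \<sigma> r) * h (x - p)) \<ge> 0" "s * ((\<sigma> y - \<sigma> r) * h (y - p)) \<ge> 0"
      using w ge less pos[OF x] pos[OF y] by auto
    ultimately have "(1 - t) * ((\<sigma> q - \<sigma> r) * h (q - p)) = 0"
      "(1 - s) * ((\<sigma> x - \<sigma> r) * h (x - p)) = 0" "s * ((\<sigma> y - \<sigma> r) * h (y - p)) = 0"
      by linarith+
    then have "t = 1" "s = 0" using qr less ge pos[OF q] pos[OF y] by auto
    then show False using w by auto
  qed
  moreover have "\<sigma> r \<le> \<sigma> y"
  proof (rule ccontr)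
    assume "\<not> ?thesis"
    with consec[OF y] have ge: "\<sigma> y \<le> \<sigma> q" by auto
    have "t * ((\<sigma> r - \<sigma> q) * h (r - p)) = (1 - s) * ((\<sigma> x - \<sigma> q) * h (x - p)) + s * ((\<sigma> y - \<sigma> q) * h (y - p))"
      using \<phi>_comb[of q t q r] \<phi>_comb[of q s x y] w(3,6) by (simp add: \<phi>_eq[OF q] \<phi>_eq[OF r] \<phi>_eq[OF x] \<phi>_eq[OF y])
    moreover have "t * ((\<sigma> r - \<sigma> q) * h (r - p)) \<ge> 0"
      using w qr pos[OF r] by simp
    moreover have "(1 - s) * ((\<sigma> x - \<sigma> q) * h (x - p)) \<le> 0" "s * ((\<sigma> y - \<sigma> q) * h (y - p)) \<le> 0"
      using w ge less pos[OF x] pos[OF y] by (auto simp: mult_le_0_iff)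
    ultimately have "t * ((\<sigma> r - \<sigma> q) * h (r - p)) = 0"
      "(1 - s) * ((\<sigma> x - \<sigma> q) * h (x - p)) = 0" "s * ((\<sigma> y - \<sigma> q) * h (y - p)) = 0"
      by linarith+
    then have "t = 0" "s = 1" using qr less ge pos[OF r] pos[OF x] by auto
    then show False using w by auto
  qed
  ultimately have ord: "\<sigma> x \<le> \<sigma> q" "\<sigma> r \<le> \<sigma> y" by auto
  obtain a b where ab: "q - p = a *\<^sub>R (x - p) + b *\<^sub>R (y - p)" "a + b \<ge> 1"
    "a + b = 1 \<Longrightarrow> q \<in> {x, y}"
    by (rule between_beyond[OF q x y less]) (use ord qr in auto)
  obtain c d where cd: "r - p = c *\<^sub>R (x - p) + d *\<^sub>R (y - p)" "c + d \<ge> 1"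
    "c + d = 1 \<Longrightarrow> r \<in> {x, y}"
    by (rule between_beyond[OF r x y less]) (use ord qr in auto)
  \<comment> \<open>The crossing point in the basis \<open>x - p\<close>, \<open>y - p\<close>,
    computed along both edges: the coefficient sum is 1 along \<open>{x, y}\<close> and an average
    of two numbers at least 1 along \<open>{q, r}\<close>.\<close>
  have "((1 - t) * a + t * c) *\<^sub>R (x - p) + ((1 - t) * b + t * d) *\<^sub>R (y - p) =
      (1 - t) *\<^sub>R (q - p) + t *\<^sub>R (r - p)"
    unfolding ab(1) cd(1) by (simp add: algebra_simps)
  also have "\<dots> = w - p" unfolding w(3) by (rule affine_comb[symmetric])
  also have "\<dots> = (1 - s) *\<^sub>R (x - p) + s *\<^sub>R (y - p)" unfolding w(6) by (rule affine_comb)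
  finally have "((1 - t) * a + t * c) + ((1 - t) * b + t * d) = (1 - s) + s"
    by (rule comb_unique[OF x y less])
  then have "(1 - t) * (a + b - 1) + t * (c + d - 1) = 0" by (simp add: algebra_simps)
  moreover have "(1 - t) * (a + b - 1) \<ge> 0" "t * (c + d - 1) \<ge> 0" using w ab cd by auto
  ultimately have "(1 - t) * (a + b - 1) = 0" "t * (c + d - 1) = 0" by linarith+
  then have "t = 1 \<or> q \<in> {x, y}" "t = 0 \<or> r \<in> {x, y}" using ab(3) cd(3) by auto
  then consider "t = 1" "r \<in> {x, y}" | "t = 0" "q \<in> {x, y}" | "q \<in> {x, y}" "r \<in> {x, y}" by auto
  then show False
  proof cases
    case 3
    then have "{q, r} = f" using qr xy(1) by auto
    then show ?thesis using cross by (simp add: crosses_def)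
  qed (use w in auto)
qed

text \<open>In slope order, the first point is joined to \<open>p\<close> and every other point to
  its predecessor, all by uncrossed edges.\<close>

lemma boundary_connected:
  "graph_connected P {e \<in> edges_on P. \<forall>f\<in>edges_on P. \<not> crosses e f}"
proof -
  let ?H = "{e \<in> edges_on P. \<forall>f\<in>edges_on P. \<not> crosses e f}"
  have "(p, q) \<in> (adj ?H)\<^sup>*" if "q \<in> P - {p}" for q
    using that
  proof (induction "card {z \<in> P - {p}. \<sigma> z < \<sigma> q}" arbitrary: q rule: less_induct)
    case less
    let ?B = "{z \<in> P - {p}. \<sigma> z < \<sigma> q}"
    have finB: "finite ?B" using fin by auto
    show ?case
    proof (cases "?B = {}")
      case True
      then have "\<not> crosses {p, q} f" if "f \<in> edges_on P" for f
        using that less.prems by (intro first_uncrossed) (auto simp: not_less[symmetric])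
      moreover have "{p, q} \<in> edges_on P" using p less.prems unfolding edges_on_def by blast
      ultimately have "(p, q) \<in> adj ?H" by auto
      then show ?thesis by (rule r_into_rtrancl)
    next
      case False
      \<comment> \<open>\<open>r\<close> is the predecessor of \<open>q\<close> in slope
        order.\<close>
      then have "Max (\<sigma> ` ?B) \<in> \<sigma> ` ?B" using finB by (intro Max_in) auto
      then obtain r where r: "r \<in> ?B" "\<sigma> r = Max (\<sigma> ` ?B)" by auto
      have max: "\<sigma> z \<le> \<sigma> r" if "z \<in> ?B" for z
        unfolding r(2) using finB that by (intro Max_ge) auto
      have "{z \<in> P - {p}. \<sigma> z < \<sigma> r} \<subset> ?B" using r(1) by auto
      with finB have "(p, r) \<in> (adj ?H)\<^sup>*"
        using r(1) by (intro less.hyps psubset_card_mono) auto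
      moreover have "\<not> crosses {r, q} f" if "f \<in> edges_on P" for f
        using that r(1) less.prems max
        by (intro consecutive_uncrossed) (auto simp: not_less[symmetric])
      moreover have "{r, q} \<in> edges_on P" using r(1) less.prems unfolding edges_on_def by blast
      ultimately show ?thesis by (auto intro: rtrancl_into_rtrancl[of p r _ q])
    qed
  qed
  then have reach: "(p, q) \<in> (adj ?H)\<^sup>*" if "q \<in> P" for q using that by (cases "q = p") auto
  show ?thesis
    unfolding graph_connected_iff
    by (intro ballI rtrancl_trans[OF adj_rtrancl_sym[OF reach] reach])
qed

end

lemma convex_position_boundary_connected:
  assumes "finite P" "convex_position P"
  shows "graph_connected P {e \<in> edges_on P. \<forall>f\<in>edges_on P. \<not> crosses e f}"
proof (cases "\<exists>p q. p \<in> P \<and> q \<in> P \<and> p \<noteq> q")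
  case True
  then obtain p q where pq: "p \<in> P" "q \<in> P" "p \<noteq> q" by blast
  let ?S = "convex hull (P - {p})"
  have "closed ?S" using assms(1) by (intro compact_imp_closed finite_imp_compact_convex_hull) auto
  moreover have "p \<notin> ?S" using assms(2) pq(1) by (rule convex_position_notin_hull)
  ultimately obtain a b where ab: "inner a p < b" "\<forall>x\<in>?S. inner a x > b"
    using separating_hyperplane_closed_point[of ?S p] by auto
  have pos: "inner a (z - p) > 0" if "z \<in> P - {p}" for z
    using ab hull_inc[of z "P - {p}" convex] that by (fastforce simp: inner_diff_right)
  have "a \<noteq> 0" using pos[of q] pq by auto
  \<comment> \<open>\<open>c\<close> is \<open>a\<close> turned by a right angle, so the inner
    products with \<open>a\<close> and \<open>c\<close> serve as coordinates \<open>h\<close> and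
    \<open>g\<close>; separation of \<open>p\<close> from the hull of the others makes
    \<open>h\<close> positive.\<close>
  define c :: point where "c = vector [- (a $ 2), a $ 1]"
  have zero: "v = 0" if "inner a v = 0" "inner c v = 0" for v :: point
  proof -
    have 1: "a $ 1 * v $ 1 + a $ 2 * v $ 2 = 0" and 2: "a $ 1 * v $ 2 = a $ 2 * v $ 1"
      using that by (simp_all add: inner_vec_def sum_2 c_def)
    have ne: "(a $ 1)\<^sup>2 + (a $ 2)\<^sup>2 \<noteq> 0"
      using \<open>a \<noteq> 0\<close> by (simp add: sum_power2_eq_zero_iff vec_eq_iff forall_2)
    have "((a $ 1)\<^sup>2 + (a $ 2)\<^sup>2) * v $ 1 = 0" "((a $ 1)\<^sup>2 + (a $ 2)\<^sup>2) * v $ 2 = 0"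
      using 1 2 by algebra+
    with ne have "v $ 1 = 0" "v $ 2 = 0" unfolding mult_eq_0_iff by blast+
    then show ?thesis by (simp add: vec_eq_iff forall_2)
  qed
  interpret fan P p "inner a" "inner c"
  proof (rule fan.intro)
    show "linear (inner a)" "linear (inner c)"
      by (rule bounded_linear.linear[OF bounded_linear_inner_right])+
  qed (fact assms(1) pq(1) zero pos | rule convex_position_notin_hull[OF assms(2)], assumption)+
  show ?thesis by (rule boundary_connected)
next
  case False
  then show ?thesis by (auto simp: graph_connected_def)
qed

section \<open>Shortest flip sequences\<close>

text \<open>The boundary graph \<open>H\<close> is compatible with every tree, so \<open>TI\<close>
  flips into a tree \<open>S\<close> inside \<open>H\<close>, and \<open>S\<close> flips directly
  into \<open>TF\<close>.\<close>

lemma ex_flip_sequence: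
  assumes fin: "finite P" and "convex_position P"
    and TI: "plane_spanning_tree P TI" and TF: "plane_spanning_tree P TF"
  shows "\<exists>T k. flip_sequence P TI TF T k"
proof -
  define H where "H = {e \<in> edges_on P. \<forall>f\<in>edges_on P. \<not> crosses e f}"
  have H: "graph_connected P H" "H \<subseteq> edges_on P"
    unfolding H_def using convex_position_boundary_connected assms(1,2) by blast+
  have Un: "noncrossing (T \<union> H)" if "plane_spanning_tree P T" for T
  proof -
    have "\<not> crosses e f" "\<not> crosses f e" if "e \<in> H" "f \<in> T \<union> H" for e f
      using that plane_spanning_tree_edges[OF \<open>plane_spanning_tree P T\<close>] crosses_sym[of e f]
      unfolding H_def by auto
    then show ?thesis
      using plane_spanning_tree_noncrossing[OF that] unfolding noncrossing_def by blast
  qed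
  obtain S m where S: "S \<subseteq> H" "plane_spanning_tree P S" "(TI, S) \<in> flip_rel P ^^ m"
    using flips_into_connected[OF fin TI H Un[OF TI]] by blast
  have "noncrossing (S \<union> TF)"
    using Un[OF TF] S(1) by (elim noncrossing_subset) auto
  then have "(S, TF) \<in> flip_rel P ^^ card (S - TF)"
    using fin S(2) TF by (intro flips_to_tree)
  with S(3) have "(TI, TF) \<in> flip_rel P ^^ (m + card (S - TF))" by (rule relpow_trans)
  then show ?thesis using ex_flip_sequence_iff[OF TI] by blast
qed

section \<open>Suffixes without later crossings\<close>

text \<open>For a flip, \<open>T j - T (Suc j)\<close> holds exactly the removed edge. At
  \<open>m = k\<close> the condition is vacuous.\<close>

definition uncrossed_suffix :: "(nat \<Rightarrow> edge set) \<Rightarrow> nat \<Rightarrow> nat \<Rightarrow> bool" where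
  "uncrossed_suffix T k m \<longleftrightarrow>
    (\<forall>j. m \<le> j \<and> j < k \<longrightarrow> (\<forall>a\<in>T j - T (Suc j). \<forall>l\<in>{Suc j..k}. \<forall>g\<in>T l. \<not> crosses g a))"

lemma shortest_relpow:
  assumes "shortest_flip_sequence P TI TF T k" "(TI, TF) \<in> flip_rel P ^^ m"
    "plane_spanning_tree P TI"
  shows "k \<le> m"
  using assms ex_flip_sequence_iff[of P TI TF m] unfolding shortest_flip_sequence_def by blast

text \<open>
  All edges of \<open>T m\<close> outside \<open>T k\<close> are removed in the suffix, hence not crossed by \<open>T k\<close>. So
  \<open>T m\<close> can be turned into \<open>T k\<close> by adding only edges of \<open>T k\<close>, and no shortest sequence wastes
  a flip on any other edge.
\<close>
lemma uncrossed_suffix_final: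
  assumes fin: "finite P" and TI: "plane_spanning_tree P TI"
    and short: "shortest_flip_sequence P TI TF T k"
    and suffix: "uncrossed_suffix T k m" and i: "m \<le> i" "i < k"
    and flip: "is_flip P (T i) e f (T (Suc i))"
  shows "final_flip T k i f"
proof -
  have seq: "T 0 = TI" "T k = TF" "\<And>i. i < k \<Longrightarrow> (T i, T (Suc i)) \<in> flip_rel P"
    using short flip_sequence_iff[OF TI] by (auto simp: shortest_flip_sequence_def)
  have tree: "plane_spanning_tree P (T i)" if "i \<le> k" for i
    using short that by (auto simp: shortest_flip_sequence_def flip_sequence_def)
  have finT: "finite (T j)" if "j \<le> k" for j using plane_spanning_tree_finite[OF fin tree[OF that]] .
  have flip_step: "\<exists>a b. a \<in> T j \<and> b \<notin> T j \<and> T (Suc j) = insert b (T j - {a})" if "j < k" for j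
    using seq(3)[OF that] by (auto simp: flip_rel_def is_flip_def)
  have removed: "\<exists>j. m \<le> j \<and> j < l \<and> a \<in> T j - T (Suc j)"
    if "a \<in> T m" "a \<notin> T l" "m \<le> l" for a l
    using that(3,2,1)
  proof (induction l rule: dec_induct)
    case (step n)
    then show ?case by (metis DiffI lessI less_Suc_eq)
  qed simp
  have "\<not> crosses g a" if "a \<in> T m - T k" "g \<in> T k" for g a
    using removed[of a k] that suffix i unfolding uncrossed_suffix_def
    by (metis DiffD1 DiffD2 Suc_leI atLeastAtMost_iff le_less_trans less_imp_le order_refl)
  then have "noncrossing (T m \<union> T k)"
    using plane_spanning_tree_noncrossing[OF tree[of m]] plane_spanning_tree_noncrossing[OF tree[of k]] i
      crosses_sym
    unfolding noncrossing_def by (metis DiffI UnE less_imp_le order_le_less_trans order_refl)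
  then have "(T m, T k) \<in> flip_rel P ^^ card (T m - T k)"
    using fin tree i by (intro flips_to_tree) auto
  moreover have "(T 0, T m) \<in> flip_rel P ^^ m"
    using relpow_suffix[of 0 m T "flip_rel P"] seq(3) i by auto
  ultimately have "(TI, TF) \<in> flip_rel P ^^ (m + card (T m - T k))"
    using seq(1,2) relpow_trans by metis
  \<comment> \<open>Replacing the suffix by direct flips gives a competing sequence, which cannot be
    shorter.\<close>
  then have long: "k \<le> m + card (T m - T k)"
    using shortest_relpow[OF short _ TI] by blast
  \<comment> \<open>A flip removes one edge, so it brings the tree at most one edge closer to
    \<open>T k\<close>.\<close>
  have drop: "card (T j - T k) \<le> Suc (card (T (Suc j) - T k))" if j: "j < k" for j
  proof -
    obtain a b where ab: "a \<in> T j" "b \<notin> T j" "T (Suc j) = insert b (T j - {a})"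
      using flip_step[OF j] by blast
    have "card (T j - T k) \<le> card (insert a (T (Suc j) - T k))"
      using ab finT[of "Suc j"] j by (intro card_mono) auto
    also have "\<dots> \<le> Suc (card (T (Suc j) - T k))" using finT[of "Suc j"] j by (simp add: card_insert_if)
    finally show ?thesis .
  qed
  have after: "card (T j - T k) \<le> k - j" if "j \<le> k" for j
    using that
  proof (induction j rule: inc_induct)
    case (step n)
    then show ?case using drop[of n] by auto
  qed simp
  have before: "card (T m - T k) \<le> (j - m) + card (T j - T k)" if "m \<le> j" "j \<le> k" for j
    using that
  proof (induction j rule: dec_induct)
    case (step n)
    then show ?case using drop[of n] by auto
  qed simp
  \<comment> \<open>With \<open>long\<close>, no flip of the suffix may fall short of progress
    one.\<close>
  have exact: "card (T j - T k) = k - j" if "m \<le> j" "j \<le> k" for j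
    using after[OF that(2)] before[OF that] long that by linarith
  \<comment> \<open>Progress one forces a flip to add an edge of \<open>T k\<close> and to remove an
    edge outside it.\<close>
  have stays: "b \<in> T k \<and> a \<notin> T k"
    if j: "m \<le> j" "j < k" and ab: "a \<in> T j" "b \<notin> T j" "T (Suc j) = insert b (T j - {a})" for j a b
  proof (rule ccontr)
    assume neg: "\<not> ?thesis"
    have less: "card (T (Suc j) - T k) < card (T j - T k)"
      using exact[of j] exact[of "Suc j"] j by auto
    show False
    proof (cases "a \<in> T k")
      case True
      then have "T j - T k \<subseteq> T (Suc j) - T k" using ab by auto
      then show False using less finT[of "Suc j"] j
        by (meson Suc_leI card_mono finite_Diff not_less)
    next
      case False
      with neg have "b \<notin> T k" by blast
      then have "T (Suc j) - T k = insert b (T j - T k - {a})" using ab(3) by auto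
      then have "card (T (Suc j) - T k) = Suc (card (T j - T k - {a}))"
        using ab(2) finT[of j] j by auto
      also have "\<dots> = card (T j - T k)"
        using ab(1) False finT[of j] j by (intro card_Suc_Diff1) auto
      finally show False using less by simp
    qed
  qed
  have f: "f \<in> T k" using stays[of i e f] i flip by (auto simp: is_flip_def)
  have "f \<in> T j" if "Suc i \<le> j" "j \<le> k" for j
    using that
  proof (induction j rule: dec_induct)
    case base
    then show ?case using flip by (auto simp: is_flip_def)
  next
    case (step n)
    then obtain a b where ab: "a \<in> T n" "b \<notin> T n" "T (Suc n) = insert b (T n - {a})"
      using flip_step[of n] by auto
    then have "a \<noteq> f" using stays[of n a b] f step i by auto
    with ab step show ?case by auto
  qed
  then show ?thesis by (auto simp: final_flip_def)
qed

text \<open>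
  If the edge \<^term>\<open>e\<close> removed from \<open>T i\<close> is not crossed later, its removal can be postponed to the
  very end: replay the remaining removals in trees \<open>U j \<subseteq> insert e (T j)\<close> starting from
  \<open>U (Suc i) = T i\<close>, and get rid of \<^term>\<open>e\<close> last. A flip that becomes void would shorten the sequence.
\<close>
lemma postpone_removal:
  assumes fin: "finite P" and TI: "plane_spanning_tree P TI"
    and short: "shortest_flip_sequence P TI TF T k"
    and suffix: "uncrossed_suffix T k m" and i: "i < m" "m \<le> k"
    and flip: "is_flip P (T i) e f (T (Suc i))"
    and unc: "\<forall>j\<in>{Suc i..k}. \<forall>g\<in>T j. \<not> crosses g e"
  shows "\<exists>N. shortest_flip_sequence P TI TF N k \<and> uncrossed_suffix N k (m - 1)"
proof -
  have seq: "T 0 = TI" "T k = TF" "\<And>i. i < k \<Longrightarrow> (T i, T (Suc i)) \<in> flip_rel P"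
    using short flip_sequence_iff[OF TI] by (auto simp: shortest_flip_sequence_def)
  have tree: "plane_spanning_tree P (T i)" if "i \<le> k" for i
    using short that by (auto simp: shortest_flip_sequence_def flip_sequence_def)
  have e: "e \<in> T i" using flip by (simp add: is_flip_def)
  define good where "good j U \<longleftrightarrow> plane_spanning_tree P U \<and> U \<subseteq> insert e (T j)" for j U
  \<comment> \<open>Only the original removal is imitated: if \<open>U\<close> lacks the removed
    edge nothing happens, otherwise the edge is exchanged for one of
    \<open>insert e (T (Suc j))\<close>, which is connected and noncrossing since \<open>e\<close>
    is not crossed.\<close>
  have extend: "\<exists>U'. good (Suc j) U' \<and> (U, U') \<in> (flip_rel P)\<^sup>= \<and> U - U' \<subseteq> T j - T (Suc j)"
    if j: "Suc i \<le> j" "j < k" and U: "good j U" for j U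
  proof -
    obtain a b where ab: "a \<in> T j" "b \<notin> T j" "T (Suc j) = insert b (T j - {a})"
      using seq(3)[OF j(2)] by (auto simp: flip_rel_def is_flip_def)
    have sub: "U - {a} \<subseteq> insert e (T (Suc j))" using U ab by (auto simp: good_def)
    show ?thesis
    proof (cases "a \<in> U")
      case False
      with sub have "U \<subseteq> insert e (T (Suc j))" by auto
      with U have "good (Suc j) U" by (simp add: good_def)
      then show ?thesis by (intro exI[of _ U]) simp
    next
      case True
      let ?G = "insert e (T (Suc j))"
      have G: "graph_connected P ?G"
        using graph_connected_mono[OF plane_spanning_tree_connected[OF tree[of "Suc j"]]] j by auto
      have GE: "?G \<subseteq> edges_on P"
        using plane_spanning_tree_edges[OF tree[of "Suc j"]] plane_spanning_tree_edges[OF tree[of i]] e i j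
        by auto
      have "noncrossing ?G"
        using unc j plane_spanning_tree_noncrossing[OF tree[of "Suc j"]]
        by (intro noncrossing_insert) auto
      then have GN: "noncrossing (U - {a} \<union> ?G)"
        using sub by (elim noncrossing_subset) auto
      have PU: "plane_spanning_tree P U" using U by (simp add: good_def)
      obtain c where c: "c \<in> ?G" "c \<notin> U - {a}" "plane_spanning_tree P (insert c (U - {a}))"
        by (rule plane_tree_exchange[OF fin PU True G GE GN])
      have "good (Suc j) (insert c (U - {a}))" using c sub by (auto simp: good_def)
      moreover have "a \<notin> T (Suc j)" using ab by auto
      ultimately show ?thesis
        using flip_relI[OF PU c(3) True c(2)] ab(1)
        by (intro exI[of _ "insert c (U - {a})"]) auto
    qed
  qed
  have "good (Suc i) (T i)"
    using tree[of i] i flip by (auto simp: good_def is_flip_def)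
  define nxt where "nxt j U = (SOME U'. good (Suc j) U' \<and> (U, U') \<in> (flip_rel P)\<^sup>= \<and>
    U - U' \<subseteq> T j - T (Suc j))" for j U
  define V where "V = rec_nat (T i) (\<lambda>n U. nxt (Suc i + n) U)"
  have V0: "V 0 = T i" and VSuc: "V (Suc n) = nxt (Suc i + n) (V n)" for n
    by (simp_all add: V_def)
  have nxt: "good (Suc j) (nxt j U) \<and> (U, nxt j U) \<in> (flip_rel P)\<^sup>= \<and> U - nxt j U \<subseteq> T j - T (Suc j)"
    if "Suc i \<le> j" "j < k" "good j U" for j U
    unfolding nxt_def using extend[OF that] by (rule someI_ex)
  have Vgood: "good (Suc i + n) (V n)" if "Suc i + n \<le> k" for n
    using that
  proof (induction n)
    case 0
    then show ?case using V0 \<open>good (Suc i) (T i)\<close> by simp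
  next
    case (Suc n)
    then show ?case using nxt[of "Suc i + n" "V n"] by (simp add: VSuc)
  qed
  have Vstep: "(V n, V (Suc n)) \<in> (flip_rel P)\<^sup>=" "V n - V (Suc n) \<subseteq> T (Suc i + n) - T (Suc (Suc i + n))"
    if "Suc i + n < k" for n
    using nxt[of "Suc i + n" "V n"] Vgood[of n] that by (simp_all add: VSuc)
  \<comment> \<open>Position \<open>j\<close> holds a tree inside
    \<open>insert e (T (Suc j))\<close>, one step ahead of the original sequence; this frees the
    last step for dropping \<open>e\<close>.\<close>
  define N where "N j = (if j \<le> i then T j else if j < k then V (j - i) else T k)" for j
  have N_V: "N j = V (j - i)" if "i \<le> j" "j < k" for j
    using that V0 by (auto simp: N_def)
  have Nk: "N k = T k" "N 0 = T 0" using i by (auto simp: N_def)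
  have N_sub: "plane_spanning_tree P (N j)" "N j \<subseteq> insert e (T (Suc j))" if "i \<le> j" "j < k" for j
    using Vgood[of "j - i"] that N_V[OF that] by (auto simp: good_def)
  have last: "N (k - 1) - T k \<subseteq> {e}" "plane_spanning_tree P (N (k - 1))"
  proof -
    have "i \<le> k - 1" "k - 1 < k" "Suc (k - 1) = k" using i by auto
    then show "N (k - 1) - T k \<subseteq> {e}" "plane_spanning_tree P (N (k - 1))"
      using N_sub[of "k - 1"] by auto
  qed
  have last_rel: "(N (k - 1), T k) \<in> (flip_rel P)\<^sup>="
  proof (cases "N (k - 1) - T k = {}")
    case True
    then have "N (k - 1) = T k"
      using plane_spanning_tree_subset_eq[OF fin last(2) tree[of k]] by auto
    then show ?thesis by simp
  next
    case False
    with last(1) have "N (k - 1) - T k = {e}" by blast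
    moreover from this have "noncrossing (N (k - 1) \<union> T k)"
    proof -
      have "N (k - 1) \<union> T k \<subseteq> insert e (T k)" using last(1) by auto
      moreover have "noncrossing (insert e (T k))"
        using unc i plane_spanning_tree_noncrossing[OF tree[of k]] by (intro noncrossing_insert) auto
      ultimately show ?thesis by (rule noncrossing_subset[rotated])
    qed
    ultimately show ?thesis
      using flips_to_tree[OF fin last(2) tree[of k]] by simp
  qed
  have lazy: "(N j, N (Suc j)) \<in> (flip_rel P)\<^sup>=" if j: "j < k" for j
  proof -
    consider "j < i" | "i \<le> j" "Suc j < k" | "i \<le> j" "Suc j = k" using j by linarith
    then show ?thesis
    proof cases
      case 1
      then show ?thesis using seq(3)[OF j] by (simp add: N_def)
    next
      case 2
      then show ?thesis using Vstep(1)[of "j - i"] N_V[of j] N_V[of "Suc j"] by (simp add: Suc_diff_le)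
    next
      case 3
      then show ?thesis using last_rel Nk by auto
    qed
  qed
  obtain l where "(N 0, N k) \<in> flip_rel P ^^ l" "(\<exists>j<k. N j = N (Suc j)) \<longrightarrow> l < k"
    using lazy_sequence_relpow[of k N "flip_rel P"] lazy by blast
  \<comment> \<open>By minimality no step is idle, so \<open>N\<close> is again a shortest flip
    sequence.\<close>
  moreover from this have "k \<le> l" using shortest_relpow[OF short _ TI] Nk seq by simp
  ultimately have "(N j, N (Suc j)) \<in> flip_rel P" if "j < k" for j
    using lazy[OF that] that by auto
  then have "flip_sequence P TI TF N k"
    using Nk seq by (simp add: flip_sequence_iff[OF TI])
  then have N_short: "shortest_flip_sequence P TI TF N k"
    using short by (simp add: shortest_flip_sequence_def)
  have "\<not> crosses g a"
    if j: "m - 1 \<le> j" "j < k" and a: "a \<in> N j - N (Suc j)" and l: "Suc j \<le> l" "l \<le> k" and g: "g \<in> N l"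
    for j a l g
  proof (cases "Suc j = k")
    case True
    then have "a \<in> N (k - 1) - T k" "g \<in> T k" using a g l Nk by auto
    moreover from this have "a = e" using last(1) by blast
    ultimately show ?thesis using unc i by auto
  next
    case False
    then have j': "i \<le> j" "Suc j < k" using i j by auto
    \<comment> \<open>Before the last step, \<open>N\<close> removes at \<open>j\<close> what
      \<open>T\<close> removes at \<open>Suc j\<close>. As \<open>Suc j\<close> is at least
      \<open>m\<close>, the suffix gains one position.\<close>
    then have a': "a \<in> T (Suc j) - T (Suc (Suc j))"
      using a Vstep(2)[of "j - i"] N_V[of j] N_V[of "Suc j"] by (auto simp: Suc_diff_le)
    have unc_a: "\<not> crosses g' a" if "g' \<in> T n" "Suc (Suc j) \<le> n" "n \<le> k" for g' n
    proof -
      have "m \<le> Suc j" using j by simp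
      then show ?thesis
        using suffix j' a' that unfolding uncrossed_suffix_def by (metis atLeastAtMost_iff)
    qed
    show ?thesis
    proof (cases "l = k")
      case True
      then show ?thesis using g Nk unc_a[of g k] j' by auto
    next
      case False
      then have "g \<in> insert e (T (Suc l))" using g N_sub(2)[of l] l j' by auto
      \<comment> \<open>The kept edge \<open>e\<close> does no harm: \<open>a\<close> belongs to a
        tree after \<open>T i\<close>, and none of these crosses \<open>e\<close>.\<close>
      moreover have "\<not> crosses e a"
        using unc a' j' crosses_sym[of e a] by auto
      ultimately show ?thesis using unc_a[of g "Suc l"] l False by auto
    qed
  qed
  then have "uncrossed_suffix N k (m - 1)" unfolding uncrossed_suffix_def by auto
  with N_short show ?thesis by blast
qed

theorem theorem4:
  fixes P :: "point set" and TI TF :: "edge set"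
  assumes "finite P"
    and "convex_position P"
    and "plane_spanning_tree P TI"
    and "plane_spanning_tree P TF"
  shows "\<exists>T k. shortest_flip_sequence P TI TF T k \<and>
           (\<forall>i<k. \<forall>e f. is_flip P (T i) e f (T (Suc i)) \<longrightarrow>
              final_flip T k i f \<or> (\<exists>j\<in>{Suc i..k}. \<exists>g\<in>T j. crosses g e))"
proof -
  define k where "k = (LEAST k. \<exists>T. flip_sequence P TI TF T k)"
  have "\<exists>T. flip_sequence P TI TF T k"
    unfolding k_def by (rule LeastI_ex) (use ex_flip_sequence[OF assms] in blast)
  then obtain T0 where "flip_sequence P TI TF T0 k" by blast
  then have T0: "shortest_flip_sequence P TI TF T0 k"
    unfolding shortest_flip_sequence_def k_def by (auto intro: Least_le)
  define suffix where
    "suffix m \<longleftrightarrow> m \<le> k \<and> (\<exists>T. shortest_flip_sequence P TI TF T k \<and> uncrossed_suffix T k m)" for m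
  \<comment> \<open>The least start is the longest suffix, over all shortest sequences at
    once.\<close>
  define m where "m = (LEAST m. suffix m)"
  have "suffix k" using T0 by (auto simp: suffix_def uncrossed_suffix_def)
  then have "suffix m" unfolding m_def by (rule LeastI)
  then obtain T where T: "m \<le> k" "shortest_flip_sequence P TI TF T k" "uncrossed_suffix T k m"
    by (auto simp: suffix_def)
  have "final_flip T k i f \<or> (\<exists>j\<in>{Suc i..k}. \<exists>g\<in>T j. crosses g e)"
    if "i < k" and flip: "is_flip P (T i) e f (T (Suc i))" for i e f
  proof (cases "m \<le> i")
    case True
    then show ?thesis
      using uncrossed_suffix_final[OF assms(1,3) T(2,3) _ that] by blast
  next
    case False
    have "\<exists>j\<in>{Suc i..k}. \<exists>g\<in>T j. crosses g e"
    proof (rule ccontr)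
      assume "\<not> ?thesis"
      then have "suffix (m - 1)"
        using postpone_removal[OF assms(1,3) T(2,3) _ T(1) flip] False T(1)
        unfolding suffix_def by auto
      \<comment> \<open>Here \<open>i < m\<close>, so \<open>m\<close> is positive and
        \<open>m - 1\<close> is truly smaller.\<close>
      then have "m \<le> m - 1" unfolding m_def by (rule Least_le)
      with False show False by simp
    qed
    then show ?thesis ..
  qed
  with T(2) show ?thesis by blast
qed

end
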